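(* Let $P$ be an ergodic Markov kernel on a finite set $\mathcal X$, $n=|\mathcal X|\ge3$, reversible with respect to the strictly positive probability distribution $\pi$, and let $k\in\{2,\ldots,n-1\}$. Let $\lambda_1\le\cdots\le\lambda_{n-1}$ be the eigenvalues of $P$ on $\ell_0^2(\pi)$ with multiplicity, with corresponding $\pi$-orthonormal eigenfunctions $\psi_1,\ldots,\psi_{n-1}$, and put $g_P=\lambda_k-\lambda_{k-1}$, $W_P=\lambda_{n-1}-\lambda_1$. For a partition $\mathcal O$ of $\mathcal X$ into $k$ nonempty blocks let $H(\mathcal O)=\bigl\|\tfrac12(P+G_{\mathcal O})-\Pi\bigr\|_{F,\pi}^2$ and $\delta_P(\mathcal O)=\sum_{j=1}^{k-1}\|(I-G_{\mathcal O})\psi_j\|_\pi^2$, and put $H_k^*=\min_{|\mathcal O|=k}H(\mathcal O)$, $\delta_{P,k}^*=\min_{|\mathcal O|=k}\delta_P(\mathcal O)$. Let $\widehat{\mathcal O}_H$ be the output of the additive-mixture multiway spectral sweep (the algorithm described in the context), let $\mathcal O^{(1)},\ldots,\mathcal O^{(\ell)}$ be the candidate partitions that it generates, and let $\overline\delta_{P,\ell}=\min_{1\le s\le\ell}\delta_P(\mathcal O^{(s)})$. Then $$0\le H(\widehat{\mathcal O}_H)-H_k^*\le\frac12\left(W_P\overline\delta_{P,\ell}-g_P\,\delta_{P,k}^*\right).$$ If at least one candidate is a $\rho$-approximation for weighted $k$-means, so that $\overline\delta_{P,\ell}\le\rho\,\delta_{P,k}^*$, then $$H(\widehat{\mathcal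 O}_H)-H_k^*\le\frac12(\rho W_P-g_P)\,\delta_{P,k}^*.$$
   Context: $\pi(x)>0$ for all $x\in\mathcal X$. $\ell^2(\pi)$ is the space of real functions on $\mathcal X$ with $\langle f,h\rangle_\pi=\sum_x\pi(x)f(x)h(x)$ and norm $\|\cdot\|_\pi$; $\ell^2_0(\pi)=\{f:\sum_x\pi(x)f(x)=0\}$. Kernels act by $(Pf)(x)=\sum_yP(x,y)f(y)$. Ergodic means irreducible and aperiodic; reversible means $\pi(x)P(x,y)=\pi(y)P(y,x)$ for all $x,y$. $\Pi(x,y)=\pi(y)$. The Gibbs kernel of $\mathcal O=\{O_1,\ldots,O_k\}$ is $G_{\mathcal O}(x,y)=\sum_{i=1}^k\mathbf 1_{O_i}(x)\mathbf 1_{O_i}(y)\pi(y)/\pi(O_i)$. For an operator $A$ on $\ell^2(\pi)$, $\|A\|_{F,\pi}^2=\operatorname{Tr}(A^*A)=\sum_{x,y}\frac{\pi(x)}{\pi(y)}A(x,y)^2$. One choice of eigenbasis $\psi_1,\ldots,\psi_{n-1}$ of $\ell^2_0(\pi)$ ($P\psi_j=\lambda_j\psi_j$) is fixed throughout. Minima over $|\mathcal O|=k$ range over all partitions of $\mathcal X$ into $k$ nonempty blocks. Additive-mixture multiway spectral sweep: (1) Compute $\psi_1,\ldots,\psi_{k-1}$ from the bottom nonconstant spectral subspace of $P$ and form the embedding $\Psi(x)=(\psi_1(x),\ldots,\psi_{k-1}(x))\in\mathbb R^{k-1}$. (2) Spectral rounding: approximately minimize $\delta_P(\mathcal O)$ by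 running weighted $k$-means on the embedded points $\Psi(x)$, with weights $\pi(x)$, from several initializations; the weighted $k$-means distortion $\sum_{i=1}^k\sum_{x\in O_i}\pi(x)\|\Psi(x)-\nu_i\|_2^2$, with $\nu_i=\pi(O_i)^{-1}\sum_{x\in O_i}\pi(x)\Psi(x)$, is exactly $\delta_P(\mathcal O)$. Retain the terminal partitions having $k$ nonempty blocks and denote them by $\mathcal O^{(1)},\ldots,\mathcal O^{(\ell)}$ (the candidates). (3) Candidate rescoring: evaluate $H$ on every candidate and return a candidate $\widehat{\mathcal O}_H$ minimizing $H(\mathcal O^{(s)})$ over $1\le s\le\ell$. *)

theory Defs
  imports "HOL-Analysis.Analysis" "HOL-Library.Disjoint_Sets"
begin

text \<open>The state space is a finite type. Functions on it are \<open>'a \<Rightarrow> real\<close>, kernels are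
  \<open>'a \<Rightarrow> 'a \<Rightarrow> real\<close>.\<close>

definition pos_distribution :: "('a::finite \<Rightarrow> real) \<Rightarrow> bool" where
  "pos_distribution \<pi> \<longleftrightarrow> (\<forall>x. \<pi> x > 0) \<and> (\<Sum>x\<in>UNIV. \<pi> x) = 1"

definition markov_kernel :: "('a::finite \<Rightarrow> 'a \<Rightarrow> real) \<Rightarrow> bool" where
  "markov_kernel P \<longleftrightarrow> (\<forall>x y. P x y \<ge> 0) \<and> (\<forall>x. (\<Sum>y\<in>UNIV. P x y) = 1)"

definition reversible :: "('a::finite \<Rightarrow> real) \<Rightarrow> ('a \<Rightarrow> 'a \<Rightarrow> real) \<Rightarrow> bool" where
  "reversible \<pi> P \<longleftrightarrow> (\<forall>x y. \<pi> x * P x y = \<pi> y * P y x)"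

primrec kernel_power :: "('a::finite \<Rightarrow> 'a \<Rightarrow> real) \<Rightarrow> nat \<Rightarrow> 'a \<Rightarrow> 'a \<Rightarrow> real" where
  "kernel_power P 0 = (\<lambda>x y. if x = y then 1 else 0)"
| "kernel_power P (Suc m) = (\<lambda>x y. \<Sum>z\<in>UNIV. P x z * kernel_power P m z y)"

definition irreducible_kernel :: "('a::finite \<Rightarrow> 'a \<Rightarrow> real) \<Rightarrow> bool" where
  "irreducible_kernel P \<longleftrightarrow> (\<forall>x y. \<exists>m. kernel_power P m x y > 0)"

definition aperiodic_kernel :: "('a::finite \<Rightarrow> 'a \<Rightarrow> real) \<Rightarrow> bool" where
  "aperiodic_kernel P \<longleftrightarrow> (\<forall>x. Gcd {m. m > 0 \<and> kernel_power P m x x > 0} = 1)"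

definition ergodic_kernel :: "('a::finite \<Rightarrow> 'a \<Rightarrow> real) \<Rightarrow> bool" where
  "ergodic_kernel P \<longleftrightarrow> irreducible_kernel P \<and> aperiodic_kernel P"

definition kernel_apply :: "('a::finite \<Rightarrow> 'a \<Rightarrow> real) \<Rightarrow> ('a \<Rightarrow> real) \<Rightarrow> 'a \<Rightarrow> real" where
  "kernel_apply A f = (\<lambda>x. \<Sum>y\<in>UNIV. A x y * f y)"

definition pi_inner :: "('a::finite \<Rightarrow> real) \<Rightarrow> ('a \<Rightarrow> real) \<Rightarrow> ('a \<Rightarrow> real) \<Rightarrow> real" where
  "pi_inner \<pi> f h = (\<Sum>x\<in>UNIV. \<pi> x * f x * h x)"

definition pi_norm :: "('a::finite \<Rightarrow> real) \<Rightarrow> ('a \<Rightarrow> real) \<Rightarrow> real" where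
  "pi_norm \<pi> f = sqrt (pi_inner \<pi> f f)"

definition l2_zero :: "('a::finite \<Rightarrow> real) \<Rightarrow> ('a \<Rightarrow> real) set" where
  "l2_zero \<pi> = {f. (\<Sum>x\<in>UNIV. \<pi> x * f x) = 0}"

text \<open>The space \<open>l2_zero \<pi>\<close> has dimension \<open>n - 1\<close>, \<open>n = CARD('a)\<close>, so \<open>n - 1\<close> orthonormal
  elements of it form a basis. Hence an eigenbasis exhibits all eigenvalues of the kernel on
  \<open>l2_zero \<pi>\<close>, with multiplicity. Indices run through \<open>{1..n - 1}\<close>; values of \<open>ev\<close> and \<open>\<psi>\<close> at
  other indices are irrelevant.\<close>

definition ordered_eigenbasis ::
  "('a::finite \<Rightarrow> real) \<Rightarrow> ('a \<Rightarrow> 'a \<Rightarrow> real) \<Rightarrow> (nat \<Rightarrow> real) \<Rightarrow> (nat \<Rightarrow> 'a \<Rightarrow> real) \<Rightarrow> bool" where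
  "ordered_eigenbasis \<pi> P ev \<psi> \<longleftrightarrow>
     mono_on {1..CARD('a) - 1} ev \<and>
     (\<forall>j\<in>{1..CARD('a) - 1}. \<psi> j \<in> l2_zero \<pi> \<and> kernel_apply P (\<psi> j) = (\<lambda>x. ev j * \<psi> j x)) \<and>
     (\<forall>i\<in>{1..CARD('a) - 1}. \<forall>j\<in>{1..CARD('a) - 1}.
        pi_inner \<pi> (\<psi> i) (\<psi> j) = (if i = j then 1 else 0))"

definition k_partitions :: "nat \<Rightarrow> 'a::finite set set set" where
  "k_partitions k = {Q. partition_on UNIV Q \<and> card Q = k}"

definition gibbs_kernel :: "('a::finite \<Rightarrow> real) \<Rightarrow> 'a set set \<Rightarrow> 'a \<Rightarrow> 'a \<Rightarrow> real" where
  "gibbs_kernel \<pi> Q = (\<lambda>x y. \<Sum>B\<in>Q. indicator B x * indicator B y * \<pi> y / (\<Sum>z\<in>B. \<pi> z))"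

text \<open>This is \<open>Tr (A\<^sup>* A)\<close> for the adjoint \<open>A\<^sup>*(x, y) = \<pi> y * A y x / \<pi> x\<close> of \<open>A\<close> with respect to
  \<open>pi_inner \<pi>\<close>.\<close>

definition frobenius_sq :: "('a::finite \<Rightarrow> real) \<Rightarrow> ('a \<Rightarrow> 'a \<Rightarrow> real) \<Rightarrow> real" where
  "frobenius_sq \<pi> A = (\<Sum>x\<in>UNIV. \<Sum>y\<in>UNIV. \<pi> x / \<pi> y * (A x y)\<^sup>2)"

definition mixture_objective ::
  "('a::finite \<Rightarrow> real) \<Rightarrow> ('a \<Rightarrow> 'a \<Rightarrow> real) \<Rightarrow> 'a set set \<Rightarrow> real" where
  "mixture_objective \<pi> P Q = frobenius_sq \<pi> (\<lambda>x y. 1/2 * (P x y + gibbs_kernel \<pi> Q x y) - \<pi> y)"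

definition spectral_defect ::
  "('a::finite \<Rightarrow> real) \<Rightarrow> (nat \<Rightarrow> 'a \<Rightarrow> real) \<Rightarrow> nat \<Rightarrow> 'a set set \<Rightarrow> real" where
  "spectral_defect \<pi> \<psi> k Q =
     (\<Sum>j=1..k-1. (pi_norm \<pi> (\<lambda>x. \<psi> j x - kernel_apply (gibbs_kernel \<pi> Q) (\<psi> j) x))\<^sup>2)"

text \<open>A vector of \<open>\<real>\<^sup>d\<close> is a function \<open>nat \<Rightarrow> real\<close> on the indices \<open>1..d\<close>. The embedding is
  restricted to them, so that it carries no information on the other eigenfunctions.\<close>

definition spectral_embedding ::
  "(nat \<Rightarrow> 'a::finite \<Rightarrow> real) \<Rightarrow> nat \<Rightarrow> 'a \<Rightarrow> nat \<Rightarrow> real" where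
  "spectral_embedding \<psi> k = (\<lambda>x. \<lambda>j\<in>{1..k-1}. \<psi> j x)"

definition centroid ::
  "('a::finite \<Rightarrow> real) \<Rightarrow> ('a \<Rightarrow> nat \<Rightarrow> real) \<Rightarrow> 'a set \<Rightarrow> nat \<Rightarrow> real" where
  "centroid w \<Psi> B = (\<lambda>j. (\<Sum>x\<in>B. w x * \<Psi> x j) / (\<Sum>x\<in>B. w x))"

definition kmeans_distortion ::
  "('a::finite \<Rightarrow> real) \<Rightarrow> nat \<Rightarrow> ('a \<Rightarrow> nat \<Rightarrow> real) \<Rightarrow> 'a set set \<Rightarrow> real" where
  "kmeans_distortion w d \<Psi> Q =
     (\<Sum>B\<in>Q. \<Sum>x\<in>B. w x * (\<Sum>j=1..d. (\<Psi> x j - centroid w \<Psi> B j)\<^sup>2))"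

definition kmeans_approximation ::
  "('a::finite \<Rightarrow> real) \<Rightarrow> nat \<Rightarrow> ('a \<Rightarrow> nat \<Rightarrow> real) \<Rightarrow> nat \<Rightarrow> real \<Rightarrow> 'a set set \<Rightarrow> bool" where
  "kmeans_approximation w d \<Psi> k \<rho> Q \<longleftrightarrow>
     Q \<in> k_partitions k \<and>
     kmeans_distortion w d \<Psi> Q \<le> \<rho> * (MIN R\<in>k_partitions k. kmeans_distortion w d \<Psi> R)"

text \<open>The weighted \<open>k\<close>-means heuristic is a black box: \<open>kmeans w \<Psi> k s\<close> is the terminal family of
  clusters for weights \<open>w\<close>, points \<open>\<Psi>\<close>, cluster number \<open>k\<close> and initialization \<open>s\<close>. No quality is
  assumed of it; runs that do not end with \<open>k\<close> nonempty blocks are discarded.\<close>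

type_synonym ('a, 'i) kmeans_routine =
  "('a \<Rightarrow> real) \<Rightarrow> ('a \<Rightarrow> nat \<Rightarrow> real) \<Rightarrow> nat \<Rightarrow> 'i \<Rightarrow> 'a set set"

definition sweep_candidates ::
  "('a::finite, 'i) kmeans_routine \<Rightarrow> 'i list \<Rightarrow> ('a \<Rightarrow> real) \<Rightarrow> (nat \<Rightarrow> 'a \<Rightarrow> real) \<Rightarrow> nat \<Rightarrow>
    'a set set list" where
  "sweep_candidates kmeans inits \<pi> \<psi> k =
     filter (\<lambda>Q. Q \<in> k_partitions k) (map (kmeans \<pi> (spectral_embedding \<psi> k) k) inits)"

text \<open>Ties in the rescoring step may be broken in any way. If there is no candidate, there is no
  output.\<close>

definition sweep_output ::
  "('a::finite, 'i) kmeans_routine \<Rightarrow> 'i list \<Rightarrow> ('a \<Rightarrow> real) \<Rightarrow> ('a \<Rightarrow> 'a \<Rightarrow> real) \<Rightarrow>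
    (nat \<Rightarrow> 'a \<Rightarrow> real) \<Rightarrow> nat \<Rightarrow> 'a set set \<Rightarrow> bool" where
  "sweep_output kmeans inits \<pi> P \<psi> k Q \<longleftrightarrow>
     is_arg_min (mixture_objective \<pi> P) (\<lambda>R. R \<in> set (sweep_candidates kmeans inits \<pi> \<psi> k)) Q"

end

theory Submission
  imports Defs
begin

text \<open>
  Put \<open>q\<^sub>j = \<parallel>G \<psi>\<^sub>j\<parallel>\<^sup>2\<close>. The Gibbs kernel \<open>G\<close> of \<open>k\<close> blocks is an orthogonal projection of rank \<open>k\<close>
  that fixes the constants, so \<open>0 \<le> q\<^sub>j \<le> 1\<close> and \<open>\<Sum>j. q\<^sub>j = k - 1\<close>. Evaluating the Frobenius norm in the
  eigenbasis gives \<open>H = c + (\<Sum>j. \<lambda>\<^sub>j * q\<^sub>j) / 2\<close>, where \<open>c\<close> depends on \<open>P\<close> and \<open>k\<close> only. The defect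
  \<open>\<delta>\<close> is the mass \<open>\<Sum>j<k. 1 - q\<^sub>j = \<Sum>j\<ge>k. q\<^sub>j\<close> that is moved from the \<open>k - 1\<close> lowest eigenvalues to the
  others. Moving it costs at least \<open>g\<close> and at most \<open>W\<close> per unit, which squeezes \<open>H\<close>, up to a constant,
  between \<open>g * \<delta> / 2\<close> and \<open>W * \<delta> / 2\<close>.
\<close>

section \<open>The weighted inner product\<close>

lemma pi_inner_commute: "pi_inner \<pi> f h = pi_inner \<pi> h f"
  by (simp add: pi_inner_def mult_ac)

lemma pi_inner_self_nonneg:
  assumes "pos_distribution \<pi>"
  shows "0 \<le> pi_inner \<pi> f f"
  using assms by (auto simp: pi_inner_def pos_distribution_def mult.assoc less_imp_le intro!: sum_nonneg)

lemma pi_norm_sq: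
  assumes "pos_distribution \<pi>"
  shows "(pi_norm \<pi> f)\<^sup>2 = pi_inner \<pi> f f"
  using pi_inner_self_nonneg[OF assms] by (simp add: pi_norm_def)

lemma pi_inner_diff_self:
  "pi_inner \<pi> (\<lambda>x. f x - h x) (\<lambda>x. f x - h x) = pi_inner \<pi> f f - 2 * pi_inner \<pi> h f + pi_inner \<pi> h h"
  by (simp add: pi_inner_def algebra_simps sum.distrib sum_subtractf sum_distrib_left)

section \<open>The Gibbs kernel as a projection\<close>

lemma sum_partition_on:
  fixes f :: "'a::finite \<Rightarrow> 'b::comm_monoid_add"
  assumes "partition_on UNIV Q"
  shows "(\<Sum>x\<in>UNIV. f x) = (\<Sum>B\<in>Q. \<Sum>x\<in>B. f x)"
proof -
  have "sum f (\<Union>Q) = (sum \<circ> sum) f Q"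
    using assms by (intro sum.Union_disjoint) (auto simp: partition_on_def disjoint_def)
  then show ?thesis
    using assms by (simp add: partition_on_def)
qed

lemma gibbs_kernel_block:
  assumes "partition_on UNIV Q" "B \<in> Q" "x \<in> B"
  shows "gibbs_kernel \<pi> Q x y = indicator B y * \<pi> y / (\<Sum>z\<in>B. \<pi> z)"
proof -
  have "gibbs_kernel \<pi> Q x y = (\<Sum>C\<in>Q. if C = B then indicator B y * \<pi> y / (\<Sum>z\<in>B. \<pi> z) else 0)"
    unfolding gibbs_kernel_def
    using assms by (intro sum.cong) (auto simp: partition_on_def disjoint_def indicator_def)
  also have "\<dots> = indicator B y * \<pi> y / (\<Sum>z\<in>B. \<pi> z)"
    using assms(2) by simp
  finally show ?thesis .
qed

text \<open>The kernel acts as conditional expectation given the block. This makes it a projection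
  and also makes its values the centroids of weighted k-means.\<close>

lemma gibbs_kernel_apply_block:
  assumes "partition_on UNIV Q" "B \<in> Q" "x \<in> B"
  shows "kernel_apply (gibbs_kernel \<pi> Q) f x = (\<Sum>y\<in>B. \<pi> y * f y) / (\<Sum>y\<in>B. \<pi> y)"
proof -
  have "kernel_apply (gibbs_kernel \<pi> Q) f x = (\<Sum>y\<in>UNIV. if y \<in> B then \<pi> y * f y / (\<Sum>z\<in>B. \<pi> z) else 0)"
    unfolding kernel_apply_def by (intro sum.cong) (auto simp: gibbs_kernel_block[OF assms])
  also have "\<dots> = (\<Sum>y\<in>B. \<pi> y * f y / (\<Sum>z\<in>B. \<pi> z))"
    by (simp add: sum.If_cases)
  finally show ?thesis
    by (simp add: sum_divide_distrib)
qed

lemma block_weight_pos: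
  assumes "pos_distribution \<pi>" "partition_on UNIV Q" "B \<in> Q"
  shows "0 < (\<Sum>y\<in>B. \<pi> y)"
  using assms by (intro sum_pos) (auto simp: partition_on_def pos_distribution_def)

lemma gibbs_kernel_apply_one:
  assumes "pos_distribution \<pi>" "partition_on UNIV Q"
  shows "kernel_apply (gibbs_kernel \<pi> Q) (\<lambda>_. 1) = (\<lambda>_. 1)"
proof
  fix x
  have "x \<in> \<Union>Q"
    using assms(2) by (simp add: partition_on_def)
  then obtain B where B: "B \<in> Q" "x \<in> B"
    by blast
  show "kernel_apply (gibbs_kernel \<pi> Q) (\<lambda>_. 1) x = 1"
    using block_weight_pos[OF assms B(1)] by (simp add: gibbs_kernel_apply_block[OF assms(2) B])
qed

text \<open>The form in which self-adjointness and idempotence of \<open>G\<close> enter the proof.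
  On a block, \<open>G f\<close> is a constant \<open>m\<close>, and \<open>m\<close> times the
  block weight is the weighted sum of \<open>f\<close> there, so one factor \<open>G f\<close> may
  be exchanged for \<open>f\<close>.\<close>

lemma gibbs_kernel_projection:
  assumes "pos_distribution \<pi>" "partition_on UNIV Q"
  defines "G \<equiv> kernel_apply (gibbs_kernel \<pi> Q)"
  shows "pi_inner \<pi> (G f) (G f) = pi_inner \<pi> (G f) f"
proof -
  have "(\<Sum>x\<in>B. \<pi> x * G f x * G f x) = (\<Sum>x\<in>B. \<pi> x * G f x * f x)" if B: "B \<in> Q" for B
  proof -
    define m where "m = (\<Sum>y\<in>B. \<pi> y * f y) / (\<Sum>y\<in>B. \<pi> y)"
    have G: "G f x = m" if "x \<in> B" for x
      unfolding G_def m_def by (rule gibbs_kernel_apply_block[OF assms(2) B that])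
    have "(\<Sum>x\<in>B. \<pi> x * G f x * G f x) = m * (m * (\<Sum>x\<in>B. \<pi> x))"
      by (simp add: G sum_distrib_left mult_ac)
    also have "m * (\<Sum>x\<in>B. \<pi> x) = (\<Sum>x\<in>B. \<pi> x * f x)"
      using block_weight_pos[OF assms(1,2) B] by (simp add: m_def)
    also have "m * (\<Sum>x\<in>B. \<pi> x * f x) = (\<Sum>x\<in>B. \<pi> x * G f x * f x)"
      by (simp add: G sum_distrib_left mult_ac)
    finally show ?thesis .
  qed
  then show ?thesis
    unfolding pi_inner_def sum_partition_on[OF assms(2)] by (rule sum.cong[OF refl])
qed

text \<open>The squared Frobenius norm of an orthogonal projection is its rank. Here a row
  \<open>x\<close> in a block of weight \<open>s\<close> contributes \<open>\<pi> x / s\<close>, so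
  each block contributes 1.\<close>

lemma frobenius_sq_gibbs_kernel:
  assumes "pos_distribution \<pi>" "partition_on UNIV Q"
  shows "frobenius_sq \<pi> (gibbs_kernel \<pi> Q) = card Q"
proof -
  have pos: "\<pi> y \<noteq> 0" for y
    using assms(1) by (metis less_irrefl pos_distribution_def)
  have "(\<Sum>x\<in>B. \<Sum>y\<in>UNIV. \<pi> x / \<pi> y * (gibbs_kernel \<pi> Q x y)\<^sup>2) = 1" if B: "B \<in> Q" for B
  proof -
    define s where "s = (\<Sum>z\<in>B. \<pi> z)"
    have s: "s > 0"
      unfolding s_def by (rule block_weight_pos[OF assms B])
    have "(\<Sum>y\<in>UNIV. \<pi> x / \<pi> y * (gibbs_kernel \<pi> Q x y)\<^sup>2) = \<pi> x / s" if "x \<in> B" for x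
    proof -
      have "(\<Sum>y\<in>UNIV. \<pi> x / \<pi> y * (gibbs_kernel \<pi> Q x y)\<^sup>2)
          = (\<Sum>y\<in>UNIV. if y \<in> B then \<pi> x / s\<^sup>2 * \<pi> y else 0)"
        using pos by (intro sum.cong)
          (auto simp: gibbs_kernel_block[OF assms(2) B that] s_def[symmetric] power2_eq_square)
      also have "\<dots> = \<pi> x / s\<^sup>2 * s"
        by (simp add: sum.If_cases s_def sum_distrib_left)
      finally show ?thesis
        using s by (simp add: power2_eq_square)
    qed
    then have "(\<Sum>x\<in>B. \<Sum>y\<in>UNIV. \<pi> x / \<pi> y * (gibbs_kernel \<pi> Q x y)\<^sup>2) = (\<Sum>x\<in>B. \<pi> x / s)"
      by simp
    also have "\<dots> = 1"
      using s by (simp add: s_def sum_divide_distrib[symmetric])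
    finally show ?thesis .
  qed
  then show ?thesis
    \<comment> \<open>The pattern confines the splitting into blocks to the outer variable.\<close>
    unfolding frobenius_sq_def sum_partition_on[OF assms(2), of "\<lambda>x. \<Sum>y\<in>UNIV. _ x y"] by simp
qed

section \<open>Completeness of the eigenbasis and traces\<close>

text \<open>Scaling by \<open>sqrt (\<pi> z)\<close> turns the functions into orthonormal rows of a
  square matrix. Its columns are then orthonormal too, and undoing the scaling gives the resolution
  of the identity.\<close>

lemma orthonormal_completeness:
  fixes \<phi> :: "nat \<Rightarrow> 'a::finite \<Rightarrow> real"
  assumes "pos_distribution \<pi>"
    and orth: "\<And>i j. i < CARD('a) \<Longrightarrow> j < CARD('a) \<Longrightarrow> pi_inner \<pi> (\<phi> i) (\<phi> j) = (if i = j then 1 else 0)"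
  shows "(\<Sum>j<CARD('a). \<phi> j x * \<phi> j y) = (if x = y then 1 / \<pi> x else 0)"
proof -
  have pos: "\<pi> z > 0" for z
    using assms(1) by (simp add: pos_distribution_def)
  \<comment> \<open>Rows and columns of \<open>A\<close> are both to be indexed by states, so the
    functions are renumbered.\<close>
  obtain h :: "'a \<Rightarrow> nat" where h: "bij_betw h UNIV {..<CARD('a)}"
    using ex_bij_betw_finite_nat[of "UNIV :: 'a set"] by (auto simp: atLeast0LessThan)
  have h_less: "h i < CARD('a)" for i
    using h by (auto simp: bij_betw_def)
  have h_eq: "h i = h j \<longleftrightarrow> i = j" for i j
    using h by (auto simp: bij_betw_def inj_on_def)
  define A :: "real ^ 'a ^ 'a" where "A = (\<chi> i z. sqrt (\<pi> z) * \<phi> (h i) z)"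
  have "(A ** transpose A) $ i $ j = pi_inner \<pi> (\<phi> (h i)) (\<phi> (h j))" for i j
  proof -
    have sqrt_mult: "sqrt (\<pi> z) * a * (sqrt (\<pi> z) * b) = \<pi> z * a * b" for z a b
    proof -
      have sqrt_mult: "sqrt (\<pi> z) * a * (sqrt (\<pi> z) * b) = (sqrt (\<pi> z) * sqrt (\<pi> z)) * a * b"
        by (simp only: mult_ac)
      then show ?thesis
        using pos[of z] by simp
    qed
    show ?thesis
      by (simp add: A_def matrix_matrix_mult_def transpose_def pi_inner_def sqrt_mult)
  qed
  then have "A ** transpose A = mat 1"
    by (simp add: vec_eq_iff mat_def orth h_less h_eq)
  \<comment> \<open>Here it counts that there are as many functions as states: a one-sided inverse
    of a square matrix is two-sided.\<close>
  then have "transpose A ** A = mat 1"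
    by (simp add: matrix_left_right_inverse)
  then have "(transpose A ** A) $ x $ y = (if x = y then 1 else 0)"
    by (simp add: mat_def)
  moreover have "(transpose A ** A) $ x $ y = sqrt (\<pi> x) * sqrt (\<pi> y) * (\<Sum>i\<in>UNIV. \<phi> (h i) x * \<phi> (h i) y)"
    by (simp add: A_def matrix_matrix_mult_def transpose_def sum_distrib_left mult_ac)
  moreover have "(\<Sum>i\<in>UNIV. \<phi> (h i) x * \<phi> (h i) y) = (\<Sum>j<CARD('a). \<phi> j x * \<phi> j y)"
    by (rule sum.reindex_bij_betw[OF h])
  ultimately have "sqrt (\<pi> x) * sqrt (\<pi> y) * (\<Sum>j<CARD('a). \<phi> j x * \<phi> j y) = (if x = y then 1 else 0)"
    by simp
  then show ?thesis
    using pos[of x] pos[of y] by (auto simp: mult.commute eq_divide_eq split: if_splits)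
qed

text \<open>The constant 1 completes the eigenfunctions to an orthonormal basis, since they all lie
  in \<open>l2_zero \<pi>\<close>. It takes the free index 0, and its contribution is the subtracted
  1.\<close>

lemma eigenbasis_completeness:
  fixes \<psi> :: "nat \<Rightarrow> 'a::finite \<Rightarrow> real"
  assumes "pos_distribution \<pi>" "ordered_eigenbasis \<pi> P ev \<psi>"
  shows "(\<Sum>j=1..CARD('a) - 1. \<psi> j x * \<psi> j y) = (if x = y then 1 / \<pi> x else 0) - 1"
proof -
  define \<phi> where "\<phi> = (\<lambda>j. if j = 0 then (\<lambda>_. 1) else \<psi> j)"
  have one: "pi_inner \<pi> (\<lambda>_. 1) (\<lambda>_. 1) = 1"
    using assms(1) by (simp add: pi_inner_def pos_distribution_def)
  have psi: "pi_inner \<pi> (\<psi> i) (\<lambda>_. 1) = 0" if "0 < i" "i < CARD('a)" for i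
    using assms(2) that by (auto simp: ordered_eigenbasis_def l2_zero_def pi_inner_def)
  have orth: "pi_inner \<pi> (\<psi> i) (\<psi> j) = (if i = j then 1 else 0)"
    if "0 < i" "i < CARD('a)" "0 < j" "j < CARD('a)" for i j
    using assms(2) that by (auto simp: ordered_eigenbasis_def)
  have "(\<Sum>j<CARD('a). \<phi> j x * \<phi> j y) = (if x = y then 1 / \<pi> x else 0)"
    using one psi orth
    by (intro orthonormal_completeness[OF assms(1)])
      (auto simp: \<phi>_def pi_inner_commute[of \<pi> "\<lambda>_. 1" "\<psi> _"])
  moreover have "{..<CARD('a)} = insert 0 {1..CARD('a) - 1}"
    by (auto simp: Suc_le_eq)
  ultimately show ?thesis
    by (simp add: \<phi>_def)
qed

text \<open>The trace of \<open>A\<^sup>* B\<close>, computed in the standard basis and in \<open>1, \<psi>\<^sub>1, \<psi>\<^sub>2, \<dots>\<close>.\<close>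

lemma eigenbasis_trace:
  fixes \<psi> :: "nat \<Rightarrow> 'a::finite \<Rightarrow> real"
  assumes "pos_distribution \<pi>" "ordered_eigenbasis \<pi> P ev \<psi>"
  shows "(\<Sum>j=1..CARD('a) - 1. pi_inner \<pi> (kernel_apply A (\<psi> j)) (kernel_apply B (\<psi> j)))
    = (\<Sum>x\<in>UNIV. \<Sum>y\<in>UNIV. \<pi> x / \<pi> y * (A x y * B x y))
      - pi_inner \<pi> (kernel_apply A (\<lambda>_. 1)) (kernel_apply B (\<lambda>_. 1))"
proof -
  let ?J = "{1..CARD('a) - 1}"
  have "(\<Sum>j\<in>?J. pi_inner \<pi> (kernel_apply A (\<psi> j)) (kernel_apply B (\<psi> j)))
      = (\<Sum>j\<in>?J. \<Sum>x\<in>UNIV. \<Sum>y\<in>UNIV. \<Sum>z\<in>UNIV. \<pi> x * A x y * B x z * (\<psi> j y * \<psi> j z))"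
  proof (intro sum.cong refl)
    fix j
    show "pi_inner \<pi> (kernel_apply A (\<psi> j)) (kernel_apply B (\<psi> j))
        = (\<Sum>x\<in>UNIV. \<Sum>y\<in>UNIV. \<Sum>z\<in>UNIV. \<pi> x * A x y * B x z * (\<psi> j y * \<psi> j z))"
      unfolding pi_inner_def kernel_apply_def mult.assoc sum_product
      by (simp add: sum_distrib_left mult_ac)
  qed
  also have "\<dots> = (\<Sum>x\<in>UNIV. \<Sum>y\<in>UNIV. \<Sum>z\<in>UNIV. \<pi> x * A x y * B x z * (\<Sum>j\<in>?J. \<psi> j y * \<psi> j z))"
    by (simp only: sum_distrib_left sum.swap[of _ "UNIV :: 'a set" ?J])
  \<comment> \<open>The diagonal part of completeness collapses \<open>z\<close> to \<open>y\<close>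
    and supplies the weight \<open>1 / \<pi> y\<close>; the \<open>- 1\<close> leaves products of
    row sums, that is, the action on constants.\<close>
  also have "\<dots> = (\<Sum>x\<in>UNIV. \<Sum>y\<in>UNIV. \<Sum>z\<in>UNIV.
      (if y = z then \<pi> x / \<pi> y * (A x y * B x y) else 0) - \<pi> x * A x y * B x z)"
    unfolding eigenbasis_completeness[OF assms] by (intro sum.cong refl) (auto simp: algebra_simps)
  also have "\<dots> = (\<Sum>x\<in>UNIV. \<Sum>y\<in>UNIV. \<pi> x / \<pi> y * (A x y * B x y))
      - (\<Sum>x\<in>UNIV. \<Sum>y\<in>UNIV. \<Sum>z\<in>UNIV. \<pi> x * A x y * B x z)"
    by (simp add: sum_subtractf)
  also have "(\<Sum>x\<in>UNIV. \<Sum>y\<in>UNIV. \<Sum>z\<in>UNIV. \<pi> x * A x y * B x z)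
      = pi_inner \<pi> (kernel_apply A (\<lambda>_. 1)) (kernel_apply B (\<lambda>_. 1))"
    unfolding pi_inner_def kernel_apply_def mult.assoc sum_product
    by (simp add: sum_distrib_left mult_ac)
  finally show ?thesis .
qed

section \<open>Expansion of the objective and its two-sided bounds\<close>

lemma row_sum_weighted:
  assumes "pos_distribution \<pi>" "kernel_apply A (\<lambda>_. 1) = (\<lambda>_. 1)"
  shows "(\<Sum>x\<in>UNIV. \<Sum>y\<in>UNIV. \<pi> x * A x y) = 1"
proof -
  have "(\<Sum>y\<in>UNIV. A x y) = 1" for x
    using fun_cong[OF assms(2), of x] by (simp add: kernel_apply_def)
  then show ?thesis
    using assms(1) by (simp add: sum_distrib_left[symmetric] pos_distribution_def)
qed

text \<open>Among partitions of fixed size, only the pairing of \<open>P\<close> with the Gibbs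
  kernel varies. The pairings of these two kernels with \<Pi> contribute -1 each and the norm of
  \<Pi> contributes +1, hence the final \<open>- 1\<close>.\<close>

lemma mixture_objective_expand:
  assumes "pos_distribution \<pi>" "kernel_apply P (\<lambda>_. 1) = (\<lambda>_. 1)" "partition_on UNIV Q"
  shows "mixture_objective \<pi> P Q = 1/4 * frobenius_sq \<pi> P
    + 1/2 * (\<Sum>x\<in>UNIV. \<Sum>y\<in>UNIV. \<pi> x / \<pi> y * (P x y * gibbs_kernel \<pi> Q x y)) + card Q / 4 - 1"
proof -
  let ?G = "gibbs_kernel \<pi> Q"
  have pos: "\<pi> y \<noteq> 0" for y
    using assms(1) by (metis less_irrefl pos_distribution_def)
  have pi1: "(\<Sum>x\<in>UNIV. \<Sum>y\<in>UNIV. \<pi> x * \<pi> y) = 1"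
    using assms(1) by (simp add: sum_product[symmetric] pos_distribution_def)
  have "\<pi> x / \<pi> y * (1/2 * (P x y + ?G x y) - \<pi> y)\<^sup>2
      = 1/4 * (\<pi> x / \<pi> y * (P x y)\<^sup>2) + 1/2 * (\<pi> x / \<pi> y * (P x y * ?G x y))
        + 1/4 * (\<pi> x / \<pi> y * (?G x y)\<^sup>2) - \<pi> x * P x y - \<pi> x * ?G x y + \<pi> x * \<pi> y" for x y
    using pos[of y] by (simp add: power2_eq_square field_simps)
  then have "mixture_objective \<pi> P Q = 1/4 * frobenius_sq \<pi> P
      + 1/2 * (\<Sum>x\<in>UNIV. \<Sum>y\<in>UNIV. \<pi> x / \<pi> y * (P x y * ?G x y)) + 1/4 * frobenius_sq \<pi> ?G
      - (\<Sum>x\<in>UNIV. \<Sum>y\<in>UNIV. \<pi> x * P x y) - (\<Sum>x\<in>UNIV. \<Sum>y\<in>UNIV. \<pi> x * ?G x y)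
      + (\<Sum>x\<in>UNIV. \<Sum>y\<in>UNIV. \<pi> x * \<pi> y)"
    unfolding mixture_objective_def frobenius_sq_def
    by (simp only: sum.distrib sum_subtractf sum_distrib_left)
  then show ?thesis
    using row_sum_weighted[OF assms(1,2)] pi1
      row_sum_weighted[OF assms(1) gibbs_kernel_apply_one[OF assms(1,3)]]
      frobenius_sq_gibbs_kernel[OF assms(1,3)] by simp
qed

text \<open>The reference choice is \<open>q j = 1\<close> for \<open>j < k\<close> and 0
  afterwards; \<open>e\<close> is the excess over it and \<open>d\<close> the displaced mass. Mass
  leaves indices with values between \<open>ev 1\<close> and \<open>ev (k - 1)\<close> and reappears
  at indices with values between \<open>ev k\<close> and \<open>ev n\<close>.\<close>

lemma mono_weighted_exchange:
  fixes ev q :: "nat \<Rightarrow> real"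
  assumes mono: "mono_on {1..n} ev" and k: "2 \<le> k" "k \<le> n"
    and q: "\<And>j. j \<in> {1..n} \<Longrightarrow> 0 \<le> q j \<and> q j \<le> 1"
    and total: "(\<Sum>j=1..n. q j) = real k - 1"
  defines "d \<equiv> (\<Sum>j=1..k-1. 1 - q j)"
    and "e \<equiv> (\<Sum>j=1..n. ev j * q j) - (\<Sum>j=1..k-1. ev j)"
  shows "(ev k - ev (k - 1)) * d \<le> e" and "e \<le> (ev n - ev 1) * d"
proof -
  have split: "(\<Sum>j=1..n. f j) = (\<Sum>j=1..k-1. f j) + (\<Sum>j=k..n. f j)" for f :: "nat \<Rightarrow> real"
    using sum.ub_add_nat[of 1 "k - 1" f "n - (k - 1)"] k by simp
  \<comment> \<open>Conservation of mass: the total \<open>k - 1\<close> is the number of indices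
    below \<open>k\<close>, so the deficit there equals the mass from \<open>k\<close> on.\<close>
  have d: "(\<Sum>j=k..n. q j) = d"
    using total k split[of q] by (simp add: d_def sum_subtractf of_nat_diff)
  have e: "e = (\<Sum>j=k..n. ev j * q j) - (\<Sum>j=1..k-1. ev j * (1 - q j))"
    unfolding e_def split[of "\<lambda>j. ev j * q j"] by (simp add: right_diff_distrib sum_subtractf)
  have le: "ev i \<le> ev j" if "1 \<le> i" "i \<le> j" "j \<le> n" for i j
    using mono that by (auto simp: mono_on_def)
  have "ev k * d \<le> (\<Sum>j=k..n. ev j * q j)"
    unfolding d[symmetric] sum_distrib_left
    using k q by (intro sum_mono mult_right_mono le) auto
  moreover have "(\<Sum>j=k..n. ev j * q j) \<le> ev n * d"
    unfolding d[symmetric] sum_distrib_left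
    using k q by (intro sum_mono mult_right_mono le) auto
  moreover have "ev 1 * d \<le> (\<Sum>j=1..k-1. ev j * (1 - q j))"
    unfolding d_def sum_distrib_left
    using k q by (intro sum_mono mult_right_mono le) auto
  moreover have "(\<Sum>j=1..k-1. ev j * (1 - q j)) \<le> ev (k - 1) * d"
    unfolding d_def sum_distrib_left
    using k q by (intro sum_mono mult_right_mono le) auto
  ultimately show "(ev k - ev (k - 1)) * d \<le> e" "e \<le> (ev n - ev 1) * d"
    by (simp_all add: e left_diff_distrib)
qed

text \<open>Since \<open>c\<close> is the same for all partitions into \<open>k\<close> blocks,
  bounds at different partitions can be compared. The \<open>1\<close> added to the sum of
  \<open>ev\<close> in \<open>c\<close> is the eigenvalue of the constants; the sum itself is the
  reference value of the exchange estimate.\<close>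

lemma mixture_objective_bounds:
  fixes \<psi> :: "nat \<Rightarrow> 'a::finite \<Rightarrow> real"
  assumes pos: "pos_distribution \<pi>" and one: "kernel_apply P (\<lambda>_. 1) = (\<lambda>_. 1)"
    and basis: "ordered_eigenbasis \<pi> P ev \<psi>"
    and k: "k \<in> {2..CARD('a) - 1}" and Q: "Q \<in> k_partitions k"
  defines "c \<equiv> 1/4 * frobenius_sq \<pi> P + 1/2 * (1 + (\<Sum>j=1..k-1. ev j)) + k / 4 - 1"
    and "\<delta> \<equiv> spectral_defect \<pi> \<psi> k Q"
  shows "c + 1/2 * ((ev k - ev (k - 1)) * \<delta>) \<le> mixture_objective \<pi> P Q"
    and "mixture_objective \<pi> P Q \<le> c + 1/2 * ((ev (CARD('a) - 1) - ev 1) * \<delta>)"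
proof -
  let ?G = "gibbs_kernel \<pi> Q" and ?J = "{1..CARD('a) - 1}"
  have part: "partition_on UNIV Q" and card: "card Q = k"
    using Q by (auto simp: k_partitions_def)
  have one_inner: "pi_inner \<pi> (\<lambda>_. 1) (\<lambda>_. 1) = 1"
    using pos by (simp add: pi_inner_def pos_distribution_def)
  note G_one = gibbs_kernel_apply_one[OF pos part]
  define q where "q = (\<lambda>j. pi_inner \<pi> (kernel_apply ?G (\<psi> j)) (kernel_apply ?G (\<psi> j)))"
  \<comment> \<open>Pythagoras: \<open>\<psi> j\<close> has norm 1, and the projection identity
    turns the expansion into \<open>1 - 2 * q j + q j\<close>.\<close>
  have defect: "(pi_norm \<pi> (\<lambda>x. \<psi> j x - kernel_apply ?G (\<psi> j) x))\<^sup>2 = 1 - q j" if "j \<in> ?J" for j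
    using basis that gibbs_kernel_projection[OF pos part, of "\<psi> j"]
    by (simp add: pi_norm_sq[OF pos] pi_inner_diff_self q_def ordered_eigenbasis_def)
  have q01: "0 \<le> q j \<and> q j \<le> 1" if "j \<in> ?J" for j
    using defect[OF that] zero_le_power2[of "pi_norm \<pi> (\<lambda>x. \<psi> j x - kernel_apply ?G (\<psi> j) x)"]
      pi_inner_self_nonneg[OF pos] by (auto simp: q_def)
  \<comment> \<open>The full trace is \<open>k\<close>, of which the constants take 1.\<close>
  have total: "(\<Sum>j\<in>?J. q j) = real k - 1"
    unfolding q_def eigenbasis_trace[OF pos basis] G_one one_inner
    using frobenius_sq_gibbs_kernel[OF pos part] card by (simp add: frobenius_sq_def power2_eq_square)
  \<comment> \<open>The projection identity removes one of the two factors \<open>?G\<close> from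
    \<open>q j\<close>, so the bare \<open>\<psi> j\<close> can absorb \<open>ev j\<close>.\<close>
  have "ev j * q j = pi_inner \<pi> (kernel_apply P (\<psi> j)) (kernel_apply ?G (\<psi> j))" if "j \<in> ?J" for j
  proof -
    have P: "kernel_apply P (\<psi> j) = (\<lambda>x. ev j * \<psi> j x)"
      using basis that by (auto simp: ordered_eigenbasis_def)
    have "q j = pi_inner \<pi> (\<psi> j) (kernel_apply ?G (\<psi> j))"
      unfolding q_def gibbs_kernel_projection[OF pos part] by (rule pi_inner_commute)
    then show ?thesis
      unfolding P by (simp add: pi_inner_def sum_distrib_left mult_ac)
  qed
  then have "(\<Sum>j\<in>?J. ev j * q j) = (\<Sum>x\<in>UNIV. \<Sum>y\<in>UNIV. \<pi> x / \<pi> y * (P x y * ?G x y)) - 1"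
    using eigenbasis_trace[OF pos basis, of P ?G] by (simp add: one G_one one_inner)
  then have H: "mixture_objective \<pi> P Q = c + 1/2 * ((\<Sum>j\<in>?J. ev j * q j) - (\<Sum>j=1..k-1. ev j))"
    unfolding mixture_objective_expand[OF pos one part] c_def card by (simp add: field_simps)
  have \<delta>: "\<delta> = (\<Sum>j=1..k-1. 1 - q j)"
    unfolding \<delta>_def spectral_defect_def using k by (intro sum.cong defect) auto
  have mono: "mono_on ?J ev"
    using basis by (simp add: ordered_eigenbasis_def)
  have k2: "2 \<le> k" "k \<le> CARD('a) - 1"
    using k by auto
  show "c + 1/2 * ((ev k - ev (k - 1)) * \<delta>) \<le> mixture_objective \<pi> P Q"
    and "mixture_objective \<pi> P Q \<le> c + 1/2 * ((ev (CARD('a) - 1) - ev 1) * \<delta>)"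
    unfolding H \<delta> using mono_weighted_exchange[OF mono k2 q01 total] by simp_all
qed

section \<open>Weighted k-means and the sweep\<close>

text \<open>The \<open>j\<close>-th coordinate of a centroid is the value of
  \<open>?G (\<psi> j)\<close> on its block, so both sides add the same squared residuals, once by
  blocks and once by eigenfunctions.\<close>

lemma kmeans_distortion_eq_spectral_defect:
  assumes pos: "pos_distribution \<pi>" and part: "partition_on UNIV Q"
  shows "kmeans_distortion \<pi> (k - 1) (spectral_embedding \<psi> k) Q = spectral_defect \<pi> \<psi> k Q"
proof -
  let ?G = "kernel_apply (gibbs_kernel \<pi> Q)"
  have "kmeans_distortion \<pi> (k - 1) (spectral_embedding \<psi> k) Q
      = (\<Sum>B\<in>Q. \<Sum>x\<in>B. \<pi> x * (\<Sum>j=1..k-1. (\<psi> j x - ?G (\<psi> j) x)\<^sup>2))"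
    unfolding kmeans_distortion_def
    by (intro sum.cong refl arg_cong2[of _ _ _ _ "(*)"])
      (simp add: spectral_embedding_def centroid_def gibbs_kernel_apply_block[OF part])
  also have "\<dots> = (\<Sum>x\<in>UNIV. \<Sum>j=1..k-1. \<pi> x * (\<psi> j x - ?G (\<psi> j) x)\<^sup>2)"
    by (simp add: sum_partition_on[OF part] sum_distrib_left)
  also have "\<dots> = (\<Sum>j=1..k-1. \<Sum>x\<in>UNIV. \<pi> x * (\<psi> j x - ?G (\<psi> j) x)\<^sup>2)"
    by (rule sum.swap)
  also have "\<dots> = spectral_defect \<pi> \<psi> k Q"
    unfolding spectral_defect_def pi_norm_sq[OF pos]
    by (simp add: pi_inner_def power2_eq_square mult.assoc)
  finally show ?thesis .
qed

text \<open>The lower bound is taken at a minimizer of \<open>H\<close>, the upper bound at a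
  candidate of least defect; the common constant cancels. The clause on \<rho> separates what a
  k-means approximation guarantees for the defect from what that guarantee implies for
  \<open>H\<close>.\<close>

theorem corollary5p3:
  fixes \<pi> :: "'a::finite \<Rightarrow> real"
    and P :: "'a \<Rightarrow> 'a \<Rightarrow> real"
    and k :: nat
    and ev :: "nat \<Rightarrow> real"
    and \<psi> :: "nat \<Rightarrow> 'a \<Rightarrow> real"
    and kmeans :: "('a, 'i) kmeans_routine"
    and inits :: "'i list"
    and Qhat :: "'a set set"
  assumes "CARD('a) \<ge> 3"
    and "pos_distribution \<pi>"
    and "markov_kernel P"
    and "ergodic_kernel P"
    and "reversible \<pi> P"
    and "k \<in> {2..CARD('a) - 1}"
    and "ordered_eigenbasis \<pi> P ev \<psi>"
    and "sweep_output kmeans inits \<pi> P \<psi> k Qhat"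
  shows
    "let g = ev k - ev (k - 1);
         W = ev (CARD('a) - 1) - ev 1;
         H = mixture_objective \<pi> P;
         \<delta> = spectral_defect \<pi> \<psi> k;
         H_opt = (MIN Q\<in>k_partitions k. H Q);
         \<delta>_opt = (MIN Q\<in>k_partitions k. \<delta> Q);
         candidates = sweep_candidates kmeans inits \<pi> \<psi> k;
         \<delta>_bar = (MIN Q\<in>set candidates. \<delta> Q)
     in 0 \<le> H Qhat - H_opt \<and>
        H Qhat - H_opt \<le> 1/2 * (W * \<delta>_bar - g * \<delta>_opt) \<and>
        (\<forall>\<rho>::real.
           ((\<exists>Q\<in>set candidates.
               kmeans_approximation \<pi> (k - 1) (spectral_embedding \<psi> k) k \<rho> Q)
              \<longrightarrow> \<delta>_bar \<le> \<rho> * \<delta>_opt) \<and>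
           (\<delta>_bar \<le> \<rho> * \<delta>_opt \<longrightarrow> H Qhat - H_opt \<le> 1/2 * (\<rho> * W - g) * \<delta>_opt))"
proof -
  note pos = assms(2) and k = assms(6) and basis = assms(7)
  have one: "kernel_apply P (\<lambda>_. 1) = (\<lambda>_. 1)"
    using assms(3) by (simp add: kernel_apply_def markov_kernel_def)
  define g where "g = ev k - ev (k - 1)"
  define W where "W = ev (CARD('a) - 1) - ev 1"
  define H where "H = mixture_objective \<pi> P"
  define \<delta> where "\<delta> = spectral_defect \<pi> \<psi> k"
  define K :: "'a set set set" where "K = k_partitions k"
  define C where "C = set (sweep_candidates kmeans inits \<pi> \<psi> k)"
  define H_opt where "H_opt = (MIN Q\<in>K. H Q)"
  define \<delta>_opt where "\<delta>_opt = (MIN Q\<in>K. \<delta> Q)"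
  define \<delta>_bar where "\<delta>_bar = (MIN Q\<in>C. \<delta> Q)"
  have fin: "finite K" "finite C"
    by (simp_all add: C_def)
  have CK: "C \<subseteq> K"
    by (auto simp: C_def K_def sweep_candidates_def)
  have Qhat: "Qhat \<in> C" "\<And>R. R \<in> C \<Longrightarrow> H Qhat \<le> H R"
    using assms(8) by (force simp: sweep_output_def is_arg_min_def C_def H_def)+
  \<comment> \<open>The existence of an output makes both index sets nonempty, so the minima are
    attained.\<close>
  have ne: "C \<noteq> {}" "K \<noteq> {}"
    using Qhat(1) CK by auto
  have mono: "ev i \<le> ev j" if "1 \<le> i" "i \<le> j" "j \<le> CARD('a) - 1" for i j
    using basis that by (auto simp: ordered_eigenbasis_def mono_on_def)
  \<comment> \<open>\<open>k \<ge> 2\<close> keeps \<open>k - 1\<close> in the range where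
    \<open>ev\<close> is monotone. The signs allow defects to be replaced by their bounds
    below.\<close>
  have g: "0 \<le> g" and W: "0 \<le> W"
    using mono[of "k - 1" k] mono[of 1 "CARD('a) - 1"] k by (auto simp: g_def W_def)
  obtain c where lower: "\<And>Q. Q \<in> K \<Longrightarrow> c + 1/2 * (g * \<delta> Q) \<le> H Q"
    and upper: "\<And>Q. Q \<in> K \<Longrightarrow> H Q \<le> c + 1/2 * (W * \<delta> Q)"
    using mixture_objective_bounds[OF pos one basis k] unfolding g_def W_def H_def \<delta>_def K_def by blast
  have "H_opt \<in> H ` K"
    unfolding H_opt_def using fin ne by (intro Min_in) auto
  then obtain Q0 where Q0: "Q0 \<in> K" "H_opt = H Q0"
    by auto
  have "\<delta>_bar \<in> \<delta> ` C"
    unfolding \<delta>_bar_def using fin ne by (intro Min_in) auto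
  then obtain Q1 where Q1: "Q1 \<in> C" "\<delta>_bar = \<delta> Q1"
    by auto
  have "H_opt \<le> H Qhat"
    unfolding H_opt_def using fin Qhat(1) CK by (intro Min_le) auto
  have "\<delta>_opt \<le> \<delta> Q0"
    unfolding \<delta>_opt_def using fin Q0 by (intro Min_le) auto
  then have "c + 1/2 * (g * \<delta>_opt) \<le> H_opt"
    using lower[OF Q0(1)] Q0(2) mult_left_mono[OF _ g] by fastforce
  \<comment> \<open>Rescoring makes \<open>Qhat\<close> at least as good for \<open>H\<close> as
    \<open>Q1\<close>, although the two may differ.\<close>
  moreover have "H Qhat \<le> c + 1/2 * (W * \<delta>_bar)"
    using Qhat(2)[OF Q1(1)] upper[of Q1] Q1 CK by auto
  ultimately have main: "H Qhat - H_opt \<le> 1/2 * (W * \<delta>_bar - g * \<delta>_opt)"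
    by argo
  have approx: "\<delta>_bar \<le> \<rho> * \<delta>_opt"
    if "Q \<in> C" "kmeans_approximation \<pi> (k - 1) (spectral_embedding \<psi> k) k \<rho> Q" for \<rho> Q
  proof -
    have eq: "kmeans_distortion \<pi> (k - 1) (spectral_embedding \<psi> k) R = \<delta> R" if "R \<in> K" for R
      using that kmeans_distortion_eq_spectral_defect[OF pos, of R k \<psi>]
      by (simp add: \<delta>_def K_def k_partitions_def)
    \<comment> \<open>The k-means optimum is the optimal defect, because the two objectives agree on
      all of \<open>K\<close>.\<close>
    have "(MIN R\<in>K. kmeans_distortion \<pi> (k - 1) (spectral_embedding \<psi> k) R) = \<delta>_opt"
      unfolding \<delta>_opt_def by (intro arg_cong[where f = Min] image_cong eq refl)
    then have "\<delta> Q \<le> \<rho> * \<delta>_opt"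
      using that CK eq[of Q] unfolding kmeans_approximation_def K_def by auto
    moreover have "\<delta>_bar \<le> \<delta> Q"
      unfolding \<delta>_bar_def using fin that by (intro Min_le) auto
    ultimately show ?thesis
      by simp
  qed
  have rho: "H Qhat - H_opt \<le> 1/2 * (\<rho> * W - g) * \<delta>_opt" if "\<delta>_bar \<le> \<rho> * \<delta>_opt" for \<rho>
  proof -
    have "W * \<delta>_bar \<le> W * (\<rho> * \<delta>_opt)"
      using that W by (rule mult_left_mono)
    with main show ?thesis
      by (simp add: algebra_simps)
  qed
  show ?thesis
    unfolding Let_def H_def[symmetric] \<delta>_def[symmetric] K_def[symmetric] C_def[symmetric]
      H_opt_def[symmetric] \<delta>_opt_def[symmetric] \<delta>_bar_def[symmetric] W_def[symmetric] g_def[symmetric]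
    using \<open>H_opt \<le> H Qhat\<close> main approx rho by auto
qed

end
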